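(* Let $\Gamma$ be a numerical semigroup with multiplicity $m$, conductor $c$ and concentration $\mathbf{C}(\Gamma)=k$. Write $c=Lm+\rho$ with $2\leq\rho\leq m$, and assume that $c>2m$. If $$\frac{m}{k^2}>\frac{L+1}{L-1},$$ then $E(\Gamma)\geq 0$, where $E(\Gamma)$ is the Eliahou number of $\Gamma$.
   Context: $\mathbb{N}$ denotes the set of nonnegative integers. A numerical semigroup $\Gamma$ is an additive submonoid of $(\mathbb{N},+)$ whose elements have greatest common divisor $1$, so that $\mathbb{N}\setminus\Gamma$ is finite; it is assumed that $\Gamma\neq\mathbb{N}$. The multiplicity is $m=m(\Gamma)=\min(\Gamma\setminus\{0\})$, the conductor is $c=c(\Gamma)=\max(\mathbb{N}\setminus\Gamma)+1$, and the delta-invariant $\delta(\Gamma)$ is the number of elements of $\Gamma$ (including $0$) that are smaller than $c$. $G$ denotes the (finite, unique) minimal system of generators of $\Gamma$. The integer $L$ is $L=\lfloor (c-1)/m\rfloor$ and $\rho=c-Lm$, which satisfies $2\leq\rho\leq m$. The concentration of $\Gamma$ is $\mathbf{C}(\Gamma)=\max\{\operatorname{next}_\Gamma(s)-s : s\in\Gamma\setminus\{0\}\}$, where $\operatorname{next}_\Gamma(s)=\min\{x\in\Gamma : s<x\}$. Eliahou number: put $q=\lceil c/m\rceil$, $\nu=qm-c$, $J_q=\{c,c+1,\ldots,c+m-1\}$, $p_q=J_q\cap G$, $d_q=J_q\setminus p_q$, and $e_s=|\{g\in G : g<c\}|$. Then $E(\Gamma)=e_s\,\delta(\Gamma)-q\,|d_q|+\nu$.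 *)

theory Defs
  imports Complex_Main
begin

definition additive_submonoid :: "nat set \<Rightarrow> bool" where
  "additive_submonoid S \<longleftrightarrow> 0 \<in> S \<and> (\<forall>x\<in>S. \<forall>y\<in>S. x + y \<in> S)"

text \<open>The trivial semigroup of all natural numbers is excluded.\<close>

definition numerical_semigroup :: "nat set \<Rightarrow> bool" where
  "numerical_semigroup S \<longleftrightarrow> additive_submonoid S \<and> Gcd S = 1 \<and> S \<noteq> UNIV"

definition multiplicity_sg :: "nat set \<Rightarrow> nat" where
  "multiplicity_sg S = (LEAST x. x \<in> S - {0})"

definition conductor :: "nat set \<Rightarrow> nat" where
  "conductor S = Max (UNIV - S) + 1"

definition delta_inv :: "nat set \<Rightarrow> nat" where
  "delta_inv S = card {x \<in> S. x < conductor S}"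

definition next_elem :: "nat set \<Rightarrow> nat \<Rightarrow> nat" where
  "next_elem S s = (LEAST x. x \<in> S \<and> s < x)"

text \<open>The set below is finite and nonempty for a numerical semigroup \<open>S\<close>, since the gap after
  \<open>s\<close> is 1 for all \<open>s \<ge> conductor S\<close>; the subtraction never truncates.\<close>

definition concentration :: "nat set \<Rightarrow> nat" where
  "concentration S = Max {next_elem S s - s | s. s \<in> S - {0}}"

definition minimal_generating :: "nat set \<Rightarrow> nat set \<Rightarrow> bool" where
  "minimal_generating S G \<longleftrightarrow>
     additive_submonoid hull G = S \<and> (\<forall>H. H \<subset> G \<longrightarrow> additive_submonoid hull H \<noteq> S)"

definition min_gens :: "nat set \<Rightarrow> nat set" where
  "min_gens S = (THE G. minimal_generating S G)"

text \<open>The definite description is justified: every additive submonoid of the natural numbers has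
  exactly one minimal system of generators.\<close>

lemma additive_submonoid_hull: "additive_submonoid (additive_submonoid hull X)"
  unfolding additive_submonoid_def hull_def by blast

lemma ex1_minimal_generating:
  assumes S: "additive_submonoid S"
  shows "\<exists>!G. minimal_generating S G"
proof -
  define A where "A = {x \<in> S. x \<noteq> 0 \<and> \<not> (\<exists>a\<in>S - {0}. \<exists>b\<in>S - {0}. x = a + b)}"
  have in_hull: "x \<in> additive_submonoid hull A" if "x \<in> S" for x
    using that
  proof (induction x rule: less_induct)
    case (less x)
    have H: "0 \<in> additive_submonoid hull A"
      "\<And>a b. a \<in> additive_submonoid hull A \<Longrightarrow> b \<in> additive_submonoid hull A
        \<Longrightarrow> a + b \<in> additive_submonoid hull A"
      by (use additive_submonoid_hull[of A] in \<open>simp_all add: additive_submonoid_def[of "_ hull _"]\<close>)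
    consider "x = 0" | "x \<in> A" | a b where "a \<in> S - {0}" "b \<in> S - {0}" "x = a + b"
      using less.prems unfolding A_def by blast
    then show ?case
    proof cases
      case 1 then show ?thesis using H by simp
    next
      case 2 then show ?thesis by (rule hull_inc)
    next
      case 3
      then have "a < x" "b < x" by auto
      with 3 less.IH H show ?thesis by blast
    qed
  qed
  have A_gen: "additive_submonoid hull A = S"
  proof
    show "additive_submonoid hull A \<subseteq> S"
      by (rule hull_minimal) (use S in \<open>auto simp: A_def\<close>)
  qed (use in_hull in blast)
  have A_sub: "A \<subseteq> X" if X: "additive_submonoid hull X = S" for X
  proof
    fix x assume x: "x \<in> A"
    show "x \<in> X"
    proof (rule ccontr)
      assume "x \<notin> X"
      have "additive_submonoid (S - {x})"
        unfolding additive_submonoid_def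
      proof (intro conjI ballI)
        show "0 \<in> S - {x}" using S x by (auto simp: A_def additive_submonoid_def)
        fix a b assume ab: "a \<in> S - {x}" "b \<in> S - {x}"
        then have "a + b \<in> S" using S by (auto simp: additive_submonoid_def)
        moreover have "a + b \<noteq> x"
        proof
          assume "a + b = x"
          with ab have "a \<noteq> 0" "b \<noteq> 0" by auto
          with ab x \<open>a + b = x\<close> show False by (auto simp: A_def)
        qed
        ultimately show "a + b \<in> S - {x}" by blast
      qed
      moreover have "X \<subseteq> S - {x}"
        using hull_subset[of X additive_submonoid] X \<open>x \<notin> X\<close> by blast
      ultimately have "additive_submonoid hull X \<subseteq> S - {x}" by (rule hull_minimal[rotated])
      with X x show False by (auto simp: A_def)
    qed
  qed
  show ?thesis
  proof (rule ex1I[of _ A])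
    show "minimal_generating S A"
      using A_gen A_sub unfolding minimal_generating_def by blast
    show "G = A" if "minimal_generating S G" for G
      using that A_gen A_sub[of G] unfolding minimal_generating_def by blast
  qed
qed

definition eliahou :: "nat set \<Rightarrow> int" where
  "eliahou S =
    (let m = multiplicity_sg S;
         c = conductor S;
         G = min_gens S;
         q = \<lceil>real c / real m\<rceil>;
         \<nu> = q * int m - int c;
         J = {c ..< c + m};
         p = J \<inter> G;
         d = J - p;
         e = card {g \<in> G. g < c}
     in int e * int (delta_inv S) - q * int (card d) + \<nu>)"

end

theory Submission
  imports Defs
begin

text \<open>
  The generators and the elements below the conductor are counted separately. Every element of
  \<open>\<Gamma>\<close> in \<open>[m, 2m)\<close> is a minimal generator, because a sum of two nonzero elements is at least
  \<open>2m\<close>; since \<open>2m < c\<close>, all of these are counted by \<open>e\<^sub>s\<close>. Beyond \<open>m\<close>, two successive elements of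
  \<open>\<Gamma>\<close> differ by at most \<open>k\<close>, so an interval of length \<open>n\<close> starting at \<open>m\<close> contains at least
  \<open>n / k\<close> elements. For the intervals \<open>[m, 2m)\<close> and \<open>[m, c)\<close> this gives \<open>k e\<^sub>s \<ge> m\<close> and
  \<open>k \<delta> \<ge> c - m \<ge> (L - 1) m\<close>, hence
    \<open>k\<^sup>2 e\<^sub>s \<delta> \<ge> m \<cdot> (L - 1) m \<ge> k\<^sup>2 (L + 1) m\<close>,
  where the last step is the assumption on \<open>m / k\<^sup>2\<close>. As \<open>q = L + 1\<close> and \<open>|d\<^sub>q| \<le> m\<close>, the
  product \<open>e\<^sub>s \<delta>\<close> dominates \<open>q |d\<^sub>q|\<close>, and \<open>\<nu> \<ge> 0\<close>.

  The conductor and the concentration are maxima, which carry information only for finite sets.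
  Finiteness comes from \<open>finite_gaps\<close>: a submonoid with greatest common divisor 1 has a finite
  complement.
\<close>

section \<open>Finiteness of the set of gaps\<close>

lemma additive_submonoid_mult:
  assumes "additive_submonoid S" "x \<in> S"
  shows "n * x \<in> S"
  using assms by (induction n) (auto simp: additive_submonoid_def)

text \<open>The least positive difference \<open>n\<close> of two elements divides every element \<open>s\<close>: from
  \<open>x, x + n \<in> S\<close>, both \<open>s + (s div n) x\<close> and \<open>(s div n) (x + n)\<close> lie in \<open>S\<close>, and they differ
  by \<open>s mod n < n\<close>. Hence \<open>n = 1\<close>.\<close>

lemma consecutive_elements:
  assumes S: "additive_submonoid S" and gcd: "Gcd S = 1"
  obtains x where "x \<in> S" "x + 1 \<in> S"
proof -
  define P where "P n \<longleftrightarrow> n > 0 \<and> (\<exists>x\<in>S. x + n \<in> S)" for n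
  have "\<not> S \<subseteq> {0}"
    using gcd by (auto simp: subset_singleton_iff)
  then obtain a where "a \<in> S" "a > 0"
    by auto
  moreover have "0 \<in> S"
    using S by (simp add: additive_submonoid_def)
  ultimately have "P a"
    unfolding P_def by force
  define n where "n = (LEAST n. P n)"
  have "P n"
    unfolding n_def using \<open>P a\<close> by (rule LeastI)
  then obtain x where x: "n > 0" "x \<in> S" "x + n \<in> S"
    unfolding P_def by blast
  have "n dvd s" if s: "s \<in> S" for s
  proof (rule ccontr)
    assume "\<not> n dvd s"
    then have "s mod n > 0"
      by (simp add: dvd_eq_mod_eq_0)
    moreover have "(s div n) * (x + n) \<in> S" "(s div n) * x + s \<in> S"
      using S s x additive_submonoid_mult[OF S] by (auto simp: additive_submonoid_def)
    moreover have "(s div n) * x + s = (s div n) * (x + n) + s mod n"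
      by (simp add: algebra_simps)
    ultimately have "P (s mod n)"
      unfolding P_def by metis
    then have "n \<le> s mod n"
      unfolding n_def by (rule Least_le)
    with \<open>n > 0\<close> show False
      using mod_less_divisor[of n s] by linarith
  qed
  then have "n dvd Gcd S"
    by (rule Gcd_greatest)
  with gcd x that show thesis
    by simp
qed

text \<open>With \<open>x, x + 1 \<in> S\<close>, every \<open>y \<ge> x\<^sup>2\<close> has quotient \<open>q \<ge> x\<close> and remainder \<open>r < x\<close>
  modulo \<open>x\<close>, so that \<open>y = (q - r) x + r (x + 1)\<close> lies in \<open>S\<close>.\<close>

lemma finite_gaps:
  assumes "numerical_semigroup S"
  shows "finite (UNIV - S)"
proof -
  have S: "additive_submonoid S" and gcd: "Gcd S = 1" and proper: "S \<noteq> UNIV"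
    using assms by (auto simp: numerical_semigroup_def)
  obtain x where x: "x \<in> S" "x + 1 \<in> S"
    using consecutive_elements[OF S gcd] .
  have "x > 0"
  proof (rule ccontr)
    assume "\<not> x > 0"
    with x have "1 \<in> S" by simp
    then have "y \<in> S" for y
      using additive_submonoid_mult[OF S, of 1 y] by simp
    with proper show False by blast
  qed
  have "y \<in> S" if y: "y \<ge> x * x" for y
  proof -
    have "x \<le> y div x"
      using y \<open>x > 0\<close> by (simp add: less_eq_div_iff_mult_less_eq)
    moreover have "y mod x < x"
      using \<open>x > 0\<close> by simp
    ultimately have le: "y mod x \<le> y div x"
      by linarith
    have "(y div x - y mod x) * x + (y mod x) * (x + 1)
        = ((y div x - y mod x) + y mod x) * x + y mod x"
      by (simp add: algebra_simps)
    also have "\<dots> = y"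
      using le by simp
    finally have "y = (y div x - y mod x) * x + (y mod x) * (x + 1)"
      by simp
    also have "\<dots> \<in> S"
      using S x additive_submonoid_mult[OF S] unfolding additive_submonoid_def by blast
    finally show ?thesis .
  qed
  then have "UNIV - S \<subseteq> {..<x * x}"
    by (auto simp: not_less[symmetric])
  then show ?thesis
    by (rule finite_subset) simp
qed

section \<open>Conductor, concentration and density\<close>

lemma ge_conductor_mem:
  assumes "numerical_semigroup S" "x \<ge> conductor S"
  shows "x \<in> S"
proof (rule ccontr)
  assume "x \<notin> S"
  then have "x \<le> Max (UNIV - S)"
    by (intro Max_ge finite_gaps assms) simp
  with assms(2) show False
    by (simp add: conductor_def)
qed

lemma next_elem_props:
  assumes "numerical_semigroup S"
  shows "next_elem S s \<in> S" "s < next_elem S s"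
proof -
  have "max (conductor S) (s + 1) \<in> S"
    by (intro ge_conductor_mem assms) simp
  then have "\<exists>x. x \<in> S \<and> s < x"
    by (intro exI[of _ "max (conductor S) (s + 1)"]) auto
  from LeastI_ex[OF this] show "next_elem S s \<in> S" "s < next_elem S s"
    unfolding next_elem_def by auto
qed

text \<open>From the conductor on all steps have length 1, so only finitely many step lengths occur and
  their maximum bounds each of them.\<close>

lemma next_elem_le_concentration:
  assumes S: "numerical_semigroup S" and s: "s \<in> S - {0}"
  shows "next_elem S s \<le> s + concentration S"
proof -
  let ?D = "{next_elem S s - s | s. s \<in> S - {0}}"
  have step: "next_elem S s - s \<le> 1" if "s \<ge> conductor S" for s
  proof -
    have "s + 1 \<in> S"
      using that by (intro ge_conductor_mem S) simp
    then have "next_elem S s \<le> s + 1"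
      unfolding next_elem_def by (intro Least_le) simp
    then show ?thesis by simp
  qed
  have "?D \<subseteq> (\<lambda>s. next_elem S s - s) ` {..<conductor S} \<union> {..1}"
  proof
    fix d assume "d \<in> ?D"
    then obtain s where "d = next_elem S s - s" by blast
    then show "d \<in> (\<lambda>s. next_elem S s - s) ` {..<conductor S} \<union> {..1}"
      using step[of s] by (cases "s < conductor S") auto
  qed
  then have "finite ?D"
    by (rule finite_subset) simp
  then have "next_elem S s - s \<le> concentration S"
    unfolding concentration_def by (rule Max_ge) (use s in blast)
  then show ?thesis
    by simp
qed

text \<open>The intervals \<open>[s, s + k)\<close> with \<open>s \<in> S\<close> cover everything from \<open>a\<close> on: take for \<open>s\<close> the
  largest element of \<open>S\<close> that does not exceed the given number.\<close>

lemma card_interval_ge: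
  fixes S :: "nat set"
  assumes a: "a \<in> S" and succ: "\<And>s. s \<in> S \<Longrightarrow> a \<le> s \<Longrightarrow> \<exists>t\<in>S. s < t \<and> t \<le> s + k"
  shows "b - a \<le> k * card (S \<inter> {a..<b})"
proof -
  have "{a..<b} \<subseteq> (\<Union>s\<in>S \<inter> {a..<b}. {s..<s + k})"
  proof
    fix x assume x: "x \<in> {a..<b}"
    define s where "s = Max (S \<inter> {a..x})"
    have ne: "finite (S \<inter> {a..x})" "S \<inter> {a..x} \<noteq> {}"
      using a x by auto
    have s: "s \<in> S \<inter> {a..x}"
      unfolding s_def by (rule Max_in[OF ne])
    then obtain t where t: "t \<in> S" "s < t" "t \<le> s + k"
      using succ by auto
    have "x < t"
    proof (rule ccontr)
      assume "\<not> x < t"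
      with s t have "t \<in> S \<inter> {a..x}" by auto
      then have "t \<le> s" unfolding s_def by (rule Max_ge[OF ne(1)])
      with t show False by simp
    qed
    with s t x show "x \<in> (\<Union>s\<in>S \<inter> {a..<b}. {s..<s + k})"
      by (intro UN_I[of s]) auto
  qed
  then have "card {a..<b} \<le> card (\<Union>s\<in>S \<inter> {a..<b}. {s..<s + k})"
    by (intro card_mono) auto
  also have "\<dots> \<le> (\<Sum>s\<in>S \<inter> {a..<b}. card {s..<s + k})"
    by (rule card_UN_le) simp
  finally show ?thesis
    by (simp add: mult.commute)
qed

section \<open>Multiplicity and minimal generators\<close>

lemma multiplicity_props:
  assumes "numerical_semigroup S"
  shows "multiplicity_sg S \<in> S" "multiplicity_sg S > 0"
    and "\<And>x. x \<in> S \<Longrightarrow> x \<noteq> 0 \<Longrightarrow> multiplicity_sg S \<le> x"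
proof -
  have "\<exists>x. x \<in> S - {0}"
    using next_elem_props[OF assms, of 0] by (intro exI[of _ "next_elem S 0"]) simp
  from LeastI_ex[OF this] show "multiplicity_sg S \<in> S" "multiplicity_sg S > 0"
    unfolding multiplicity_sg_def by auto
  show "multiplicity_sg S \<le> x" if "x \<in> S" "x \<noteq> 0" for x
    unfolding multiplicity_sg_def using that by (intro Least_le) simp
qed

text \<open>If \<open>g\<close> is not a sum of two nonzero elements, then \<open>S - {g}\<close> is again a submonoid, so a
  generating set cannot avoid \<open>g\<close>.\<close>

lemma irreducible_mem_min_gens:
  assumes S: "additive_submonoid S" and g: "g \<in> S" "g \<noteq> 0"
    and irred: "\<And>a b. a \<in> S \<Longrightarrow> b \<in> S \<Longrightarrow> a \<noteq> 0 \<Longrightarrow> b \<noteq> 0 \<Longrightarrow> a + b \<noteq> g"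
  shows "g \<in> min_gens S"
proof (rule ccontr)
  assume notin: "g \<notin> min_gens S"
  have "minimal_generating S (min_gens S)"
    unfolding min_gens_def by (rule theI'[OF ex1_minimal_generating[OF S]])
  then have gen: "additive_submonoid hull (min_gens S) = S"
    by (simp add: minimal_generating_def)
  have "a + b \<noteq> g" if "a \<in> S - {g}" "b \<in> S - {g}" for a b
    using that irred[of a b] by (cases "a = 0"; cases "b = 0") auto
  then have "additive_submonoid (S - {g})"
    using S g by (auto simp: additive_submonoid_def)
  moreover have "min_gens S \<subseteq> S - {g}"
    using hull_subset[of "min_gens S" additive_submonoid] gen notin by auto
  ultimately have "additive_submonoid hull (min_gens S) \<subseteq> S - {g}"
    by (rule hull_minimal[rotated])
  with gen g show False by blast
qed

lemma below_twice_multiplicity_subset_min_gens: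
  assumes S: "numerical_semigroup S"
  shows "S \<inter> {multiplicity_sg S..<2 * multiplicity_sg S} \<subseteq> min_gens S"
proof
  fix g assume g: "g \<in> S \<inter> {multiplicity_sg S..<2 * multiplicity_sg S}"
  show "g \<in> min_gens S"
  proof (rule irreducible_mem_min_gens)
    show "additive_submonoid S"
      using S by (simp add: numerical_semigroup_def)
    show "g \<in> S" "g \<noteq> 0"
      using g multiplicity_props(2)[OF S] by auto
    show "a + b \<noteq> g" if "a \<in> S" "b \<in> S" "a \<noteq> 0" "b \<noteq> 0" for a b
      using g multiplicity_props(3)[OF S, of a] multiplicity_props(3)[OF S, of b] that by auto
  qed
qed

section \<open>Nonnegativity of the Eliahou number\<close>

theorem theorem4p4:
  fixes \<Gamma> :: "nat set" and m c k L \<rho> :: nat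
  assumes "numerical_semigroup \<Gamma>"
    and "m = multiplicity_sg \<Gamma>"
    and "c = conductor \<Gamma>"
    and "concentration \<Gamma> = k"
    and "c = L * m + \<rho>" and "2 \<le> \<rho>" and "\<rho> \<le> m"
    and "c > 2 * m"
    and "real m / (real k)\<^sup>2 > (real L + 1) / (real L - 1)"
  shows "eliahou \<Gamma> \<ge> 0"
proof -
  have m: "m \<in> \<Gamma>" "m > 0"
    using multiplicity_props[OF assms(1)] assms(2) by auto
  have dense: "b - m \<le> k * card (\<Gamma> \<inter> {m..<b})" for b
  proof (rule card_interval_ge[OF m(1)])
    fix s assume s: "s \<in> \<Gamma>" "m \<le> s"
    then have "s \<in> \<Gamma> - {0}" using m by auto
    then have "next_elem \<Gamma> s \<le> s + k"
      using next_elem_le_concentration[OF assms(1)] assms(4) by auto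
    then show "\<exists>t\<in>\<Gamma>. s < t \<and> t \<le> s + k"
      using next_elem_props[OF assms(1)] by blast
  qed
  define e where "e = card {g \<in> min_gens \<Gamma>. g < c}"
  define \<delta> where "\<delta> = delta_inv \<Gamma>"
  define d where "d = card ({c..<c + m} - {c..<c + m} \<inter> min_gens \<Gamma>)"
  have "card (\<Gamma> \<inter> {m..<2 * m}) \<le> e"
    unfolding e_def using below_twice_multiplicity_subset_min_gens[OF assms(1)] assms(2,8)
    by (intro card_mono) auto
  then have ke: "m \<le> k * e"
    using dense[of "2 * m"] mult_le_mono2[of "card (\<Gamma> \<inter> {m..<2 * m})" e k] by linarith
  have "card (\<Gamma> \<inter> {m..<c}) \<le> \<delta>"
    unfolding \<delta>_def delta_inv_def assms(3) by (intro card_mono) auto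
  then have k\<delta>: "c - m \<le> k * \<delta>"
    using dense[of c] mult_le_mono2[of "card (\<Gamma> \<inter> {m..<c})" \<delta> k] by linarith
  have d: "d \<le> m"
    unfolding d_def using card_mono[of "{c..<c + m}" "{c..<c + m} - {c..<c + m} \<inter> min_gens \<Gamma>"]
    by simp

  have L: "L \<ge> 2"
  proof (rule ccontr)
    assume "\<not> L \<ge> 2"
    then have "L * m \<le> 1 * m"
      by (intro mult_le_mono1) simp
    with assms(5,7,8) show False by simp
  qed
  \<comment> \<open>A division by zero would make the left-hand side of the assumption vanish.\<close>
  have k: "k > 0"
    using assms(9) L by (cases "k = 0") (auto simp: divide_less_0_iff)
  have hyp: "(real L + 1) * (real k)\<^sup>2 \<le> real m * (real L - 1)"
    using assms(9) L k by (simp add: field_simps)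
  have "(real L - 1) * real m \<le> real (c - m)"
    using assms(5,8) by (simp add: of_nat_diff algebra_simps)
  also have "\<dots> \<le> real (k * \<delta>)"
    using k\<delta> by (rule of_nat_mono)
  finally have k\<delta>': "(real L - 1) * real m \<le> real k * real \<delta>"
    by simp
  have ke': "real m \<le> real k * real e"
    using ke by (metis of_nat_le_iff of_nat_mult)
  have "(real k)\<^sup>2 * ((real L + 1) * real m) = ((real L + 1) * (real k)\<^sup>2) * real m"
    by (simp add: algebra_simps)
  also have "\<dots> \<le> (real m * (real L - 1)) * real m"
    by (intro mult_right_mono hyp) simp
  also have "\<dots> = real m * ((real L - 1) * real m)"
    by simp
  also have "\<dots> \<le> (real k * real e) * (real k * real \<delta>)"
    using L by (intro mult_mono ke' k\<delta>') auto
  also have "\<dots> = (real k)\<^sup>2 * (real e * real \<delta>)"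
    by (simp add: power2_eq_square)
  finally have "(real L + 1) * real m \<le> real e * real \<delta>"
    using k by simp
  then have "real ((L + 1) * m) \<le> real (e * \<delta>)"
    by (simp add: algebra_simps)
  then have main: "(L + 1) * m \<le> e * \<delta>"
    by (simp only: of_nat_le_iff)
  have q: "\<lceil>real c / real m\<rceil> = int L + 1"
    using assms(5,6,7) m(2) by (intro ceiling_unique) (auto simp: field_simps)
  have "(L + 1) * d \<le> e * \<delta>"
    using main mult_le_mono2[OF d, of "L + 1"] by linarith
  then have "int ((L + 1) * d) \<le> int (e * \<delta>)"
    by (simp only: of_nat_le_iff)
  moreover have "int c \<le> int ((L + 1) * m)"
    using assms(5,7) by simp
  ultimately have "0 \<le> int e * int \<delta> - (int L + 1) * int d + ((int L + 1) * int m - int c)"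
    by (simp add: algebra_simps)
  also have "\<dots> = eliahou \<Gamma>"
    unfolding eliahou_def Let_def assms(2)[symmetric] assms(3)[symmetric] q e_def \<delta>_def d_def ..
  finally show ?thesis .
qed

end
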